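(* Let $X$ be an infinite $\mathsf{T}_1$ Lindelöf topological space. Then the following are equivalent: (1) $X$ is weakly Menger, i.e. $X$ has the property $\mathsf{S}_{fin}(\mathcal{O},\mathcal{D})$. (2) Player ONE does not have a winning strategy in the game $\mathsf{G}_{fin}^{\omega}(\mathcal{O},\mathcal{D})$ on $X$.
   Context: A space is Lindelöf if each open cover has a countable subset that covers the space (no separation axiom is included in the definition). For a topological space $X$: $\mathcal{O}$ is the collection of all open covers of $X$; $\mathcal{D}$ is the collection of families of open subsets of $X$ whose union is dense in $X$. Let $\mathcal{A},\mathcal{B}$ be collections of families of sets. $\mathsf{S}_{fin}(\mathcal{A},\mathcal{B})$ is the statement: for each sequence $(A_n:n\in\mathbb{N})$ of elements of $\mathcal{A}$ there is a sequence $(B_n:n\in\mathbb{N})$ such that each $B_n$ is a finite subset of $A_n$ and $\bigcup\{B_n:n\in\mathbb{N}\}\in\mathcal{B}$. The game $\mathsf{G}_{fin}^{\omega}(\mathcal{A},\mathcal{B})$: players ONE and TWO play an inning for each $n<\omega$. In inning $n$ ONE first chooses $O_n\in\mathcal{A}$, then TWO responds with a finite subset $T_n$ of $O_n$. TWO wins the play if $\bigcup_{n<\omega}T_n\in\mathcal{B}$; otherwise ONE wins. A strategy of a player prescribes that player's next move as a function of the opponent's moves so far; it is winning if every play in which the player follows it is won by that player. *)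

theory Defs
  imports "HOL-Analysis.Analysis"
begin

definition open_covers :: "'a topology \<Rightarrow> 'a set set set" where
  "open_covers X = {\<U>. (\<forall>U\<in>\<U>. openin X U) \<and> \<Union>\<U> = topspace X}"

definition dense_open_families :: "'a topology \<Rightarrow> 'a set set set" where
  "dense_open_families X =
     {\<U>. (\<forall>U\<in>\<U>. openin X U) \<and> X closure_of (\<Union>\<U>) = topspace X}"

definition S_fin :: "'a set set set \<Rightarrow> 'a set set set \<Rightarrow> bool" where
  "S_fin \<A> \<B> \<longleftrightarrow>
     (\<forall>A :: nat \<Rightarrow> 'a set set. (\<forall>n. A n \<in> \<A>) \<longrightarrow>
        (\<exists>B :: nat \<Rightarrow> 'a set set. (\<forall>n. finite (B n) \<and> B n \<subseteq> A n) \<and> (\<Union>n. B n) \<in> \<B>))"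

definition weakly_Menger :: "'a topology \<Rightarrow> bool" where
  "weakly_Menger X \<longleftrightarrow> S_fin (open_covers X) (dense_open_families X)"

text \<open>
  In the game, \<open>Q\<^sub>n\<close> is the move of ONE and \<open>T\<^sub>n\<close> the move of TWO in inning \<open>n\<close>.
  A strategy \<open>\<sigma>\<close> of ONE maps the list \<open>[T\<^sub>0, \<dots>, T\<^bsub>n-1\<^esub>]\<close> of the moves of TWO so far
  to the move \<open>Q\<^sub>n\<close>; its own earlier moves are recovered by applying \<open>\<sigma>\<close> to the
  initial segments of that list.
\<close>

definition G_fin_play ::
  "'a set set set \<Rightarrow> (nat \<Rightarrow> 'a set set) \<Rightarrow> (nat \<Rightarrow> 'a set set) \<Rightarrow> bool" where
  "G_fin_play \<A> Q T \<longleftrightarrow> (\<forall>n. Q n \<in> \<A> \<and> finite (T n) \<and> T n \<subseteq> Q n)"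

definition G_fin_TWO_wins :: "'a set set set \<Rightarrow> (nat \<Rightarrow> 'a set set) \<Rightarrow> bool" where
  "G_fin_TWO_wins \<B> T \<longleftrightarrow> (\<Union>n. T n) \<in> \<B>"

text \<open>
  A strategy has to prescribe a legal move only at the positions that can be reached by legal
  moves of TWO against it; its values on all other lists are irrelevant.
\<close>

definition G_fin_ONE_strategy ::
  "'a set set set \<Rightarrow> ('a set set list \<Rightarrow> 'a set set) \<Rightarrow> bool" where
  "G_fin_ONE_strategy \<A> \<sigma> \<longleftrightarrow>
     (\<forall>ts. (\<forall>k<length ts. finite (ts ! k) \<and> ts ! k \<subseteq> \<sigma> (take k ts)) \<longrightarrow> \<sigma> ts \<in> \<A>)"

definition ONE_follows ::
  "('a set set list \<Rightarrow> 'a set set) \<Rightarrow> (nat \<Rightarrow> 'a set set) \<Rightarrow> (nat \<Rightarrow> 'a set set) \<Rightarrow> bool" where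
  "ONE_follows \<sigma> Q T \<longleftrightarrow> (\<forall>n. Q n = \<sigma> (map T [0..<n]))"

definition G_fin_ONE_winning_strategy ::
  "'a set set set \<Rightarrow> 'a set set set \<Rightarrow> ('a set set list \<Rightarrow> 'a set set) \<Rightarrow> bool" where
  "G_fin_ONE_winning_strategy \<A> \<B> \<sigma> \<longleftrightarrow>
     G_fin_ONE_strategy \<A> \<sigma> \<and>
     (\<forall>Q T. G_fin_play \<A> Q T \<and> ONE_follows \<sigma> Q T \<longrightarrow> \<not> G_fin_TWO_wins \<B> T)"

end

theory Submission
  imports Defs
begin

text \<open>
  For the nontrivial direction, cut each move of ONE down to a countable subcover and let TWO answer
  in position \<open>s\<close> with the sets among the first \<open>m\<close>, so that positions become finite sequences of
  numbers. Let \<open>W s m\<close> be the open set covered by TWO once \<open>m\<close> is played in position \<open>s\<close>. It increases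
  with \<open>m\<close> and with further moves, so a point of \<open>W s m\<close> lies in \<open>W t k\<close> for every \<open>k\<close> and every \<open>t\<close>
  that continues \<open>s\<close> by a number \<open>\<ge> m\<close>. Hence the intersection of \<open>W s m\<close> over the infinitely many
  positions \<open>s\<close> of length at most \<open>n\<close> is determined by the finitely many \<open>s\<close> with entries below \<open>m\<close>: it
  is open, and these intersections cover the space as \<open>m\<close> varies. Applying the weak Menger property to
  these covers, one for each \<open>n\<close>, gives a play of numbers that defeats the strategy of ONE.
\<close>

lemma closure_of_eq_topspace_mono:
  assumes "X closure_of S = topspace X" "S \<subseteq> T"
  shows "X closure_of T = topspace X"
  using closure_of_mono[OF assms(2), of X] assms(1) closure_of_subset_topspace[of X T] by simp

text \<open>Positions are lists with the most recent move first, so \<open>W (m # s)\<close> is \<open>W s m\<close> from above.\<close>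

locale increasing_cover_tree =
  fixes X :: "'a topology" and W :: "nat list \<Rightarrow> 'a set"
  assumes openin_W: "openin X (W s)"
    and W_extend: "W s \<subseteq> W (m # s)"
    and W_mono: "m \<le> m' \<Longrightarrow> W (m # s) \<subseteq> W (m' # s)"
    and W_cover: "x \<in> topspace X \<Longrightarrow> \<exists>m. x \<in> W (m # s)"
begin

definition uniform :: "nat \<Rightarrow> nat \<Rightarrow> 'a set" where
  "uniform n m = (\<Inter>s\<in>{s. length s \<le> n}. W (m # s))"

lemma uniform_subset: "length s \<le> n \<Longrightarrow> uniform n m \<subseteq> W (m # s)"
  by (auto simp: uniform_def)

lemma uniform_mono: "m \<le> m' \<Longrightarrow> uniform n m \<subseteq> uniform n m'"
  using W_mono by (fastforce simp: uniform_def)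

text \<open>An entry \<open>j\<close> \<ge> \<open>m\<close> was played at a position of length at
  most \<open>n\<close>, where \<open>m\<close> alone already catches every point of
  \<open>uniform n m\<close>. By monotonicity so does \<open>j\<close>, and later moves lose
  nothing.\<close>

lemma uniform_subset_large_entry:
  assumes "length s \<le> Suc n" "\<not> set s \<subseteq> {..<m}"
  shows "uniform n m \<subseteq> W s"
  using assms
proof (induction s)
  case (Cons j s)
  show ?case
  proof (cases "m \<le> j")
    case True
    then show ?thesis
      using uniform_subset[of s n m] W_mono[OF True, of s] Cons.prems by auto
  next
    case False
    then show ?thesis
      using Cons W_extend[of s j] by auto
  qed
qed simp

lemma uniform_0: "uniform 0 m = W [m]"
  by (auto simp: uniform_def)

text \<open>At a position with an entry not below \<open>m\<close>, the factor
  \<open>uniform n m\<close> already lies in \<open>W s\<close>. This leaves finitely many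
  positions, which makes openness provable by induction.\<close>

lemma uniform_Suc:
  "uniform (Suc n) m =
     uniform n m \<inter> \<Inter>((\<lambda>s. W (m # s)) ` {s. set s \<subseteq> {..<m} \<and> length s \<le> Suc n})"
  (is "?L = ?R")
proof
  show "?L \<subseteq> ?R"
    by (auto simp: uniform_def)
  show "?R \<subseteq> ?L"
  proof
    fix x assume x: "x \<in> ?R"
    have "x \<in> W (m # s)" if "length s \<le> Suc n" for s
      using x that uniform_subset_large_entry[OF that, of m] W_extend[of s m]
      by (cases "set s \<subseteq> {..<m}") auto
    then show "x \<in> ?L"
      by (auto simp: uniform_def)
  qed
qed

lemma openin_uniform: "openin X (uniform n m)"
proof (induction n)
  case 0
  show ?case
    by (simp add: uniform_0 openin_W)
next
  case (Suc n)
  let ?S = "{s. set s \<subseteq> {..<m} \<and> length s \<le> Suc n}"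
  have "finite ?S"
    by (simp add: finite_lists_length_le)
  \<comment> \<open>Finite intersections of open sets are open in \<open>X\<close> only for nonempty
    families.\<close>
  moreover have "[] \<in> ?S"
    by simp
  ultimately have "openin X (\<Inter>((\<lambda>s. W (m # s)) ` ?S))"
    using openin_W by (intro openin_Inter) blast+
  with Suc show ?case
    unfolding uniform_Suc by (rule openin_Int)
qed

lemma uniform_cover:
  assumes "x \<in> topspace X"
  shows "\<exists>m. x \<in> uniform n m"
proof (induction n)
  case 0
  show ?case
    using W_cover[OF assms] by (simp add: uniform_0)
next
  case (Suc n)
  then obtain m where m: "x \<in> uniform n m"
    by blast
  obtain k where k: "x \<in> W (k s # s)" for s
    using W_cover[OF assms] by metis
  let ?S = "{s. set s \<subseteq> {..<m} \<and> length s \<le> Suc n}"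
  \<comment> \<open>\<open>M\<close> may be smaller than \<open>m\<close>: at positions outside
    \<open>?S\<close> the point is already in \<open>W s\<close>, so any next move keeps it.\<close>
  define M where "M = Max (k ` ?S)"
  have "x \<in> W (M # s)" if "length s \<le> Suc n" for s
  proof (cases "set s \<subseteq> {..<m}")
    case True
    then have "k s \<in> k ` ?S"
      using that by blast
    then have "k s \<le> M"
      unfolding M_def by (intro Max_ge finite_imageI finite_lists_length_le) simp_all
    then show ?thesis
      using W_mono k by blast
  next
    case False
    then show ?thesis
      using uniform_subset_large_entry[OF that] m W_extend by blast
  qed
  then show ?case
    by (auto simp: uniform_def)
qed

lemma weakly_Menger_dense_branch:
  assumes "weakly_Menger X"
  shows "\<exists>g. X closure_of (\<Union>n. W (rev (map g [0..<n]))) = topspace X"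
proof -
  have "(\<Union>m. uniform n m) = topspace X" for n
    using uniform_cover[of _ n] openin_subset[OF openin_uniform[of n]] by auto
  then have "range (uniform n) \<in> open_covers X" for n
    using openin_uniform by (auto simp: open_covers_def)
  then obtain B where B: "\<forall>n. finite (B n) \<and> B n \<subseteq> range (uniform n)"
    and dense: "(\<Union>n. B n) \<in> dense_open_families X"
    using assms[unfolded weakly_Menger_def S_fin_def, rule_format, of "\<lambda>n. range (uniform n)"]
    by auto
  have "\<exists>m. \<Union>(B n) \<subseteq> uniform n m" for n
  proof -
    obtain I where I: "finite I" "B n = uniform n ` I"
      using B finite_subset_image[of "B n" "uniform n" UNIV] by auto
    have "uniform n i \<subseteq> uniform n (Max I)" if "i \<in> I" for i
      using I(1) that by (intro uniform_mono Max_ge)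
    \<comment> \<open>If \<open>I\<close> is empty, \<open>Max I\<close> is unspecified, but then so
      is nothing to cover: \<open>B n\<close> is empty.\<close>
    then have "\<Union>(B n) \<subseteq> uniform n (Max I)"
      unfolding I(2) by blast
    then show ?thesis ..
  qed
  then obtain g where g: "\<Union>(B n) \<subseteq> uniform n (g n)" for n
    by metis
  \<comment> \<open>The position before inning \<open>n\<close> has length exactly \<open>n\<close>,
    so \<open>g n\<close> works there whatever the earlier choices were.\<close>
  have "\<Union>(B n) \<subseteq> W (rev (map g [0..<Suc n]))" for n
    using g[of n] uniform_subset[of "rev (map g [0..<n])" n "g n"] by auto
  then have sub: "\<Union>(\<Union>n. B n) \<subseteq> (\<Union>n. W (rev (map g [0..<n])))"
    by blast
  have "X closure_of \<Union>(\<Union>n. B n) = topspace X"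
    using dense by (simp add: dense_open_families_def)
  then have "X closure_of (\<Union>n. W (rev (map g [0..<n]))) = topspace X"
    using sub by (rule closure_of_eq_topspace_mono)
  then show ?thesis
    by (rule exI[of _ g])
qed

end

lemma Lindelof_increasing_finite_subfamilies:
  assumes "Lindelof_space X" "\<U> \<in> open_covers X"
  shows "\<exists>F :: nat \<Rightarrow> 'a set set.
    (\<forall>m. finite (F m) \<and> F m \<subseteq> \<U>) \<and> mono F \<and> (\<Union>m. \<Union>(F m)) = topspace (X :: 'a topology)"
proof -
  obtain \<C> where \<C>: "countable \<C>" "\<C> \<subseteq> \<U>" "\<Union>\<C> = topspace X"
    using assms(1)[unfolded Lindelof_space_def, rule_format, of \<U>] assms(2)
    by (auto simp: open_covers_def)
  \<comment> \<open>An injection into the numbers, unlike an enumeration, also handles an empty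
    subcover.\<close>
  define F where "F m = {c \<in> \<C>. to_nat_on \<C> c \<le> m}" for m
  have "finite (F m)" for m
  proof (rule finite_imageD)
    show "finite (to_nat_on \<C> ` F m)"
      by (rule finite_subset[of _ "{..m}"]) (auto simp: F_def)
    show "inj_on (to_nat_on \<C>) (F m)"
      using inj_on_to_nat_on[OF \<C>(1)] by (rule inj_on_subset) (auto simp: F_def)
  qed
  moreover have "mono F"
    by (auto simp: mono_def F_def)
  moreover have "(\<Union>m. \<Union>(F m)) = topspace X"
    unfolding \<C>(3)[symmetric] by (auto simp: F_def)
  ultimately show ?thesis
    using \<C>(2) by (intro exI[of _ F]) (auto simp: F_def)
qed

text \<open>Decodes a position, latest number first, into the history of TWO in chronological order,
  as strategies expect; \<open>F ts m\<close> is answer number \<open>m\<close> to the history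
  \<open>ts\<close>.\<close>

primrec moves :: "('b list \<Rightarrow> nat \<Rightarrow> 'b) \<Rightarrow> nat list \<Rightarrow> 'b list" where
  "moves F [] = []"
| "moves F (m # s) = moves F s @ [F (moves F s) m]"

lemma moves_branch:
  "moves F (rev (map g [0..<n])) = map (\<lambda>k. F (moves F (rev (map g [0..<k]))) (g k)) [0..<n]"
  by (induction n) auto

lemma G_fin_ONE_strategy_beaten:
  assumes "Lindelof_space X" "weakly_Menger X" and \<sigma>: "G_fin_ONE_strategy (open_covers X) \<sigma>"
  shows "\<exists>Q T. G_fin_play (open_covers X) Q T \<and> ONE_follows \<sigma> Q T \<and>
    G_fin_TWO_wins (dense_open_families X) T"
proof -
  let ?P = "\<lambda>\<U> F. (\<forall>m :: nat. finite (F m) \<and> F m \<subseteq> \<U>) \<and> mono F \<and>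
    (\<Union>m. \<Union>(F m)) = topspace X"
  define F where "F ts = (SOME F. ?P (\<sigma> ts) F)" for ts
  have F: "?P (\<sigma> ts) (F ts)" if "\<sigma> ts \<in> open_covers X" for ts
    unfolding F_def by (rule someI_ex[OF Lindelof_increasing_finite_subfamilies[OF assms(1) that]])
  \<comment> \<open>The choice of \<open>F ts\<close> is meaningful only where
    \<open>\<sigma>\<close> plays a cover, which is guaranteed only after legal histories. So
    legality is carried along the induction: a legal history yields a cover, and a cover yields a
    legal answer.\<close>
  have "\<forall>k<length (moves F s).
      finite (moves F s ! k) \<and> moves F s ! k \<subseteq> \<sigma> (take k (moves F s))" for s
  proof (induction s)
    case (Cons m s)
    then have "\<sigma> (moves F s) \<in> open_covers X"
      by (rule \<sigma>[unfolded G_fin_ONE_strategy_def, THEN spec, THEN mp])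
    from F[OF this] Cons show ?case
      by (auto simp: nth_append less_Suc_eq)
  qed simp
  then have cover: "\<sigma> (moves F s) \<in> open_covers X" for s
    by (rule \<sigma>[unfolded G_fin_ONE_strategy_def, THEN spec, THEN mp])
  have F_sub: "finite (F (moves F s) m)" "F (moves F s) m \<subseteq> \<sigma> (moves F s)"
    and F_mono: "mono (F (moves F s))"
    and F_cover: "(\<Union>m. \<Union>(F (moves F s) m)) = topspace X" for s m
    using F[OF cover] by auto
  define W where "W s = \<Union>(\<Union>(set (moves F s)))" for s
  interpret increasing_cover_tree X W
  proof
    have "openin X U" if "U \<in> F (moves F s) m" for U s m
      using that F_sub(2) cover unfolding open_covers_def by blast
    then have "\<forall>U\<in>\<Union>(set (moves F s)). openin X U" for s
      by (induction s) auto
    then show "openin X (W s)" for s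
      unfolding W_def by blast
    show "W s \<subseteq> W (m # s)" for s m
      by (auto simp: W_def)
    show "W (m # s) \<subseteq> W (m' # s)" if "m \<le> m'" for m m' s
    proof -
      have "F (moves F s) m \<subseteq> F (moves F s) m'"
        using F_mono that by (rule monoD)
      then show ?thesis
        by (auto simp: W_def)
    qed
    show "\<exists>m. x \<in> W (m # s)" if "x \<in> topspace X" for x s
    proof -
      have "x \<in> (\<Union>m. \<Union>(F (moves F s) m))"
        using F_cover that by simp
      then show ?thesis
        by (auto simp: W_def)
    qed
  qed
  obtain g where g: "X closure_of (\<Union>n. W (rev (map g [0..<n]))) = topspace X"
    using weakly_Menger_dense_branch[OF assms(2)] ..
  define T where "T n = F (moves F (rev (map g [0..<n]))) (g n)" for n
  define Q where "Q n = \<sigma> (map T [0..<n])" for n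
  have moves_T: "moves F (rev (map g [0..<n])) = map T [0..<n]" for n
    unfolding T_def by (rule moves_branch)
  have T_sub: "finite (T n) \<and> T n \<subseteq> Q n" and Q_cover: "Q n \<in> open_covers X" for n
    unfolding Q_def moves_T[symmetric] T_def using F_sub cover by auto
  have "(\<Union>n. W (rev (map g [0..<n]))) \<subseteq> \<Union>(\<Union>n. T n)"
    unfolding W_def moves_T by auto
  with g have "X closure_of \<Union>(\<Union>n. T n) = topspace X"
    by (rule closure_of_eq_topspace_mono)
  moreover have "openin X U" if "U \<in> T n" for U n
    using that T_sub Q_cover unfolding open_covers_def by blast
  ultimately have "G_fin_TWO_wins (dense_open_families X) T"
    unfolding G_fin_TWO_wins_def dense_open_families_def by blast
  moreover have "G_fin_play (open_covers X) Q T"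
    using T_sub Q_cover by (simp add: G_fin_play_def)
  moreover have "ONE_follows \<sigma> Q T"
    by (simp add: ONE_follows_def Q_def)
  ultimately show ?thesis
    by blast
qed

text \<open>ONE can play a given sequence of covers while ignoring TWO; the moves of TWO in a play
  that ONE loses are the required selection.\<close>

lemma S_fin_if_no_ONE_winning_strategy:
  assumes "\<nexists>\<sigma>. G_fin_ONE_winning_strategy \<A> \<B> \<sigma>"
  shows "S_fin \<A> \<B>"
  unfolding S_fin_def
proof (intro allI impI)
  fix A :: "nat \<Rightarrow> 'a set set"
  assume A: "\<forall>n. A n \<in> \<A>"
  let ?\<sigma> = "\<lambda>ts :: 'a set set list. A (length ts)"
  have "G_fin_ONE_strategy \<A> ?\<sigma>"
    using A by (simp add: G_fin_ONE_strategy_def)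
  then obtain Q T where "G_fin_play \<A> Q T" "ONE_follows ?\<sigma> Q T" "G_fin_TWO_wins \<B> T"
    using assms unfolding G_fin_ONE_winning_strategy_def by blast
  then show "\<exists>B. (\<forall>n. finite (B n) \<and> B n \<subseteq> A n) \<and> (\<Union>n. B n) \<in> \<B>"
    by (intro exI[of _ T]) (simp add: G_fin_play_def ONE_follows_def G_fin_TWO_wins_def)
qed

theorem theorem27:
  fixes X :: "'a topology"
  assumes "infinite (topspace X)"
    and "t1_space X"
    and "Lindelof_space X"
  shows "weakly_Menger X \<longleftrightarrow>
    \<not> (\<exists>\<sigma>. G_fin_ONE_winning_strategy (open_covers X) (dense_open_families X) \<sigma>)"
proof
  assume "weakly_Menger X"
  then show "\<not> (\<exists>\<sigma>. G_fin_ONE_winning_strategy (open_covers X) (dense_open_families X) \<sigma>)"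
    using G_fin_ONE_strategy_beaten[OF assms(3)] unfolding G_fin_ONE_winning_strategy_def by blast
next
  assume "\<not> (\<exists>\<sigma>. G_fin_ONE_winning_strategy (open_covers X) (dense_open_families X) \<sigma>)"
  then show "weakly_Menger X"
    unfolding weakly_Menger_def by (rule S_fin_if_no_ONE_winning_strategy)
qed

end
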